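(* Let $X$ be a nonempty set and $K>0$, let $G:X\times X\times X\to[0,\infty)$ satisfy the properties (G1), (G2), (G3), (G4) and (G5'), and suppose that $(X,G,K)$ is $G$-complete. Let $T:X\to X$ be a mapping such that $T^n$ is Lipschitzian for all $n\ge1$ and $\lim_{n\to\infty}\mathrm{Lip}(T^n)=0$. Then $T$ has a unique fixed point $x^*\in X$ if and only if the orbit $\{T^nx : n\ge 1\}$ is bounded for some $x\in X$. In fact, if there exists $x^*$ such that $Tx^*=x^*$, then $T$ is a Picard operator.
   Context: The properties are: (G1) $G(x,y,z)=0$ if $x=y=z$; (G2) $G(x,x,y)>0$ whenever $x\ne y$; (G3) $G(x,x,y)\le G(x,y,z)$ whenever $z\neq y$; (G4) $G$ is symmetric in its three variables; (G5') $G(x,y,z)\le K[G(x,z_1,z_1)+G(z_1,y,z)]$ for all $x,y,z,z_1\in X$. A sequence $(x_n)$ in $X$ is $G$-convergent to $x\in X$ if $\lim_{n,m\to\infty}G(x,x_n,x_m)=0$. It is $G$-Cauchy if for each $\varepsilon>0$ there is $N\in\mathbb N$ with $G(x_n,x_m,x_m)<\varepsilon$ for all $m,n\ge N$. The space is $G$-complete if every $G$-Cauchy sequence is $G$-convergent in $X$. A mapping $S:X\to X$ is Lipschitzian if there is a constant $k\ge0$ with $G(Sx,Sy,Sz)\le k\,G(x,y,z)$ for all $x,y,z\in X$; the smallest such constant is denoted $\mathrm{Lip}(S)$. A subset $Y\subseteq X$ is bounded if $\sup\{G(x,y,z):x,y,z\in Y\}<\infty$. $T$ is a Picard operator if it has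 a unique fixed point $x^*$ and, for every $x\in X$, the sequence $(T^nx)$ $G$-converges to $x^*$. *)

theory Defs
  imports Complex_Main "HOL-Library.FuncSet"
begin

text \<open>
  The space is a carrier set \<open>X\<close> of an arbitrary type; \<open>G\<close> is total on the type, but all
  notions only look at its values on \<open>X\<close>.
\<close>

locale generalized_G_metric =
  fixes X :: "'a set" and G :: "'a \<Rightarrow> 'a \<Rightarrow> 'a \<Rightarrow> real" and K :: real
  assumes carrier_nonempty: "X \<noteq> {}"
    and K_pos: "K > 0"
    and G_nonneg: "\<And>x y z. x \<in> X \<Longrightarrow> y \<in> X \<Longrightarrow> z \<in> X \<Longrightarrow> 0 \<le> G x y z"
    and G1: "\<And>x y z. x \<in> X \<Longrightarrow> y \<in> X \<Longrightarrow> z \<in> X \<Longrightarrow> x = y \<Longrightarrow> y = z \<Longrightarrow> G x y z = 0"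
    and G2: "\<And>x y. x \<in> X \<Longrightarrow> y \<in> X \<Longrightarrow> x \<noteq> y \<Longrightarrow> 0 < G x x y"
    and G3: "\<And>x y z. x \<in> X \<Longrightarrow> y \<in> X \<Longrightarrow> z \<in> X \<Longrightarrow> z \<noteq> y \<Longrightarrow> G x x y \<le> G x y z"
    and G4: "\<And>x y z. x \<in> X \<Longrightarrow> y \<in> X \<Longrightarrow> z \<in> X \<Longrightarrow>
               G x y z = G x z y \<and> G x y z = G y x z \<and> G x y z = G y z x \<and>
               G x y z = G z x y \<and> G x y z = G z y x"
    and G5': "\<And>x y z z1. x \<in> X \<Longrightarrow> y \<in> X \<Longrightarrow> z \<in> X \<Longrightarrow> z1 \<in> X \<Longrightarrow>
               G x y z \<le> K * (G x z1 z1 + G z1 y z)"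

definition G_convergent_to :: "('a \<Rightarrow> 'a \<Rightarrow> 'a \<Rightarrow> real) \<Rightarrow> (nat \<Rightarrow> 'a) \<Rightarrow> 'a \<Rightarrow> bool" where
  "G_convergent_to G u x \<longleftrightarrow>
     ((\<lambda>(n, m). G x (u n) (u m)) \<longlongrightarrow> 0) (sequentially \<times>\<^sub>F sequentially)"

definition G_Cauchy :: "('a \<Rightarrow> 'a \<Rightarrow> 'a \<Rightarrow> real) \<Rightarrow> (nat \<Rightarrow> 'a) \<Rightarrow> bool" where
  "G_Cauchy G u \<longleftrightarrow>
     (\<forall>\<epsilon>>0. \<exists>N. \<forall>m\<ge>N. \<forall>n\<ge>N. G (u n) (u m) (u m) < \<epsilon>)"

definition G_complete :: "'a set \<Rightarrow> ('a \<Rightarrow> 'a \<Rightarrow> 'a \<Rightarrow> real) \<Rightarrow> bool" where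
  "G_complete X G \<longleftrightarrow>
     (\<forall>u. (\<forall>n. u n \<in> X) \<and> G_Cauchy G u \<longrightarrow> (\<exists>x\<in>X. G_convergent_to G u x))"

definition G_Lipschitz_const ::
    "'a set \<Rightarrow> ('a \<Rightarrow> 'a \<Rightarrow> 'a \<Rightarrow> real) \<Rightarrow> ('a \<Rightarrow> 'a) \<Rightarrow> real \<Rightarrow> bool" where
  "G_Lipschitz_const X G S k \<longleftrightarrow>
     k \<ge> 0 \<and> (\<forall>x\<in>X. \<forall>y\<in>X. \<forall>z\<in>X. G (S x) (S y) (S z) \<le> k * G x y z)"

definition G_Lipschitzian ::
    "'a set \<Rightarrow> ('a \<Rightarrow> 'a \<Rightarrow> 'a \<Rightarrow> real) \<Rightarrow> ('a \<Rightarrow> 'a) \<Rightarrow> bool" where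
  "G_Lipschitzian X G S \<longleftrightarrow> (\<exists>k. G_Lipschitz_const X G S k)"

text \<open>Only meaningful for Lipschitzian \<open>S\<close>; see \<open>G_Lip_is_least\<close> below.\<close>

definition G_Lip :: "'a set \<Rightarrow> ('a \<Rightarrow> 'a \<Rightarrow> 'a \<Rightarrow> real) \<Rightarrow> ('a \<Rightarrow> 'a) \<Rightarrow> real" where
  "G_Lip X G S = (LEAST k. G_Lipschitz_const X G S k)"

lemma (in generalized_G_metric) G_Lip_is_least:
  assumes "G_Lipschitzian X G S"
  shows "G_Lipschitz_const X G S (G_Lip X G S)"
    and "G_Lipschitz_const X G S k \<Longrightarrow> G_Lip X G S \<le> k"
proof -
  let ?A = "{k. G_Lipschitz_const X G S k}"
  have ne: "?A \<noteq> {}"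
    using assms by (auto simp: G_Lipschitzian_def)
  have bdd: "bdd_below ?A"
    by (rule bdd_belowI[of _ 0]) (auto simp: G_Lipschitz_const_def)
  have "G (S x) (S y) (S z) \<le> Inf ?A * G x y z" if xyz: "x \<in> X" "y \<in> X" "z \<in> X" for x y z
  proof (cases "G x y z = 0")
    case True
    then show ?thesis
      using ne xyz by (force simp: G_Lipschitz_const_def)
  next
    case False
    with G_nonneg[OF xyz] have pos: "G x y z > 0"
      by simp
    have "G (S x) (S y) (S z) / G x y z \<le> Inf ?A"
      by (rule cInf_greatest[OF ne]) (use xyz pos in \<open>auto simp: G_Lipschitz_const_def field_simps\<close>)
    with pos show ?thesis
      by (simp add: field_simps)
  qed
  moreover have "Inf ?A \<ge> 0"
    by (rule cInf_greatest[OF ne]) (auto simp: G_Lipschitz_const_def)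
  ultimately have Inf: "G_Lipschitz_const X G S (Inf ?A)"
    by (auto simp: G_Lipschitz_const_def)
  have le: "Inf ?A \<le> k" if "G_Lipschitz_const X G S k" for k
    using that bdd by (auto intro: cInf_lower)
  have eq: "G_Lip X G S = Inf ?A"
    unfolding G_Lip_def by (rule Least_equality) (use Inf le in auto)
  show "G_Lipschitz_const X G S (G_Lip X G S)"
    using Inf eq by simp
  show "G_Lip X G S \<le> k" if "G_Lipschitz_const X G S k"
    using le[OF that] eq by simp
qed

definition G_bounded :: "('a \<Rightarrow> 'a \<Rightarrow> 'a \<Rightarrow> real) \<Rightarrow> 'a set \<Rightarrow> bool" where
  "G_bounded G Y \<longleftrightarrow> bdd_above {G x y z |x y z. x \<in> Y \<and> y \<in> Y \<and> z \<in> Y}"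

definition Picard_operator ::
    "'a set \<Rightarrow> ('a \<Rightarrow> 'a \<Rightarrow> 'a \<Rightarrow> real) \<Rightarrow> ('a \<Rightarrow> 'a) \<Rightarrow> bool" where
  "Picard_operator X G T \<longleftrightarrow>
     (\<exists>p\<in>X. T p = p \<and> (\<forall>q\<in>X. T q = q \<longrightarrow> q = p) \<and>
        (\<forall>x\<in>X. G_convergent_to G (\<lambda>n. (T ^^ n) x) p))"

end

theory Submission
  imports Defs
begin

text \<open>
  Shifting an orbit \<open>u\<close> by \<open>N\<close> steps multiplies all its \<open>G\<close>-values by at most \<open>Lip (T ^^ N)\<close>, so a
  bounded orbit is \<open>G\<close>-Cauchy, and its limit is fixed because \<open>T\<close> itself is Lipschitzian.
  Conversely, \<open>G (u n) p p \<le> Lip (T ^^ n) * G x p p\<close> for a fixed point \<open>p\<close>, which yields both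
  uniqueness and convergence of every orbit.
\<close>

context generalized_G_metric
begin

text \<open>Reduces the double limit to a single one: by symmetry \<open>G p (u n) (u m)\<close> is
  \<open>G (u n) p (u m)\<close>, and \<open>G5'\<close> with \<open>p\<close> as intermediate point
  splits it into a term in \<open>n\<close> and a term in \<open>m\<close>.\<close>

lemma G_convergent_toI:
  assumes p: "p \<in> X" and u: "\<And>n. u n \<in> X" and lim: "(\<lambda>n. G (u n) p p) \<longlonglongrightarrow> 0"
  shows "G_convergent_to G u p"
proof -
  have lim2: "((\<lambda>(n, m). K * (G (u n) p p + G (u m) p p)) \<longlongrightarrow> K * (0 + 0))
      (sequentially \<times>\<^sub>F sequentially)"
    unfolding case_prod_unfold
    by (intro tendsto_intros filterlim_compose[OF lim])
      (simp_all only: filterlim_def filtermap_fst_prod_filter filtermap_snd_prod_filter)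
  have bounds: "0 \<le> G p (u n) (u m) \<and> G p (u n) (u m) \<le> K * (G (u n) p p + G (u m) p p)" for n m
  proof -
    have "G p (u n) (u m) = G (u n) p (u m)" "G p p (u m) = G (u m) p p" "G p (u m) p = G (u m) p p"
      using G4[OF p u u, of n m] G4[OF p p u, of m] by metis+
    with G5'[OF u p u p, of n m] G_nonneg[OF p u u, of n m] show ?thesis
      by metis
  qed
  show ?thesis
    unfolding G_convergent_to_def
  proof (rule tendsto_sandwich[OF always_eventually always_eventually tendsto_const])
    show "((\<lambda>(n, m). K * (G (u n) p p + G (u m) p p)) \<longlongrightarrow> 0) (sequentially \<times>\<^sub>F sequentially)"
      using lim2 by simp
  qed (simp_all add: bounds)
qed

lemma G_convergent_toD:
  assumes "G_convergent_to G u p"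
  shows "(\<lambda>n. G p (u n) (u n)) \<longlonglongrightarrow> 0"
proof -
  \<comment> \<open>The double limit is restricted to the diagonal.\<close>
  have "filterlim (\<lambda>n. (n, n)) (sequentially \<times>\<^sub>F sequentially) sequentially"
    by (intro filterlim_Pair filterlim_ident)
  from filterlim_compose[OF assms[unfolded G_convergent_to_def] this] show ?thesis
    by simp
qed

text \<open>\<open>G x y y\<close> and \<open>G y x x\<close> may differ. Read the former as
  \<open>G y y x\<close> and apply \<open>G5'\<close> with intermediate point \<open>x\<close>: both
  resulting terms equal \<open>G y x x\<close>.\<close>

lemma G_swap_le:
  assumes "x \<in> X" "y \<in> X"
  shows "G x y y \<le> 2 * K * G y x x"
proof -
  have "G x y y = G y y x" "G x y x = G y x x"
    using G4[of x y y] G4[of x y x] assms by blast+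
  with G5'[of y y x x] assms show ?thesis
    by simp
qed

end

locale G_metric_vanishing_Lip = generalized_G_metric X G K
  for X :: "'a set" and G K +
  fixes T :: "'a \<Rightarrow> 'a"
  assumes T_maps: "T \<in> X \<rightarrow> X"
    and T_Lipschitzian: "\<forall>n\<ge>1. G_Lipschitzian X G (T ^^ n)"
    and Lip_tendsto: "(\<lambda>n. G_Lip X G (T ^^ n)) \<longlonglongrightarrow> 0"
begin

lemma orbit_in: "x \<in> X \<Longrightarrow> (T ^^ n) x \<in> X"
  using T_maps by (induction n) auto

lemma G_iterate_le:
  assumes "n \<ge> 1" "x \<in> X" "y \<in> X" "z \<in> X"
  shows "G ((T ^^ n) x) ((T ^^ n) y) ((T ^^ n) z) \<le> G_Lip X G (T ^^ n) * G x y z"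
  using G_Lip_is_least(1)[of "T ^^ n"] T_Lipschitzian assms by (auto simp: G_Lipschitz_const_def)

lemma orbit_to_fixed_point:
  assumes p: "p \<in> X" "T p = p" and x: "x \<in> X"
  shows "(\<lambda>n. G ((T ^^ n) x) p p) \<longlonglongrightarrow> 0"
proof (rule tendsto_sandwich[OF _ _ tendsto_const])
  have fixp: "(T ^^ n) p = p" for n
    using p by (induction n) auto
  show "eventually (\<lambda>n. 0 \<le> G ((T ^^ n) x) p p) sequentially"
    using orbit_in p x G_nonneg by simp
  \<comment> \<open>The Lipschitz hypothesis starts at \<open>n = 1\<close>, so the bound is claimed
    only eventually. It applies because \<open>p\<close> is its own \<open>n\<close>-th
    iterate.\<close>
  show "eventually (\<lambda>n. G ((T ^^ n) x) p p \<le> G_Lip X G (T ^^ n) * G x p p) sequentially"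
    using eventually_ge_at_top[of 1]
    by eventually_elim (use G_iterate_le[of _ x p p] p x fixp in simp)
  show "(\<lambda>n. G_Lip X G (T ^^ n) * G x p p) \<longlonglongrightarrow> 0"
    using tendsto_mult_left_zero[OF Lip_tendsto] .
qed

lemma fixed_point_unique:
  assumes p: "p \<in> X" "T p = p" and q: "q \<in> X" "T q = q"
  shows "q = p"
proof (rule ccontr)
  assume "q \<noteq> p"
  \<comment> \<open>The orbit of \<open>q\<close> is constant, so its vanishing limit is the value
    \<open>G q p p\<close> itself, which \<open>G2\<close> makes positive.\<close>
  have "(T ^^ n) q = q" for n
    using q by (induction n) auto
  with orbit_to_fixed_point[OF p q(1)] have "G q p p = 0"
    by (simp add: LIMSEQ_const_iff)
  with G2[of p q] G4[of p p q] p q \<open>q \<noteq> p\<close> show False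
    by simp
qed

lemma Picard_operator_if_fixed_point:
  assumes "p \<in> X" "T p = p"
  shows "Picard_operator X G T"
  unfolding Picard_operator_def
proof (intro bexI conjI ballI impI)
  show "G_convergent_to G (\<lambda>n. (T ^^ n) x) p" if "x \<in> X" for x
    by (rule G_convergent_toI[OF assms(1) orbit_in orbit_to_fixed_point]) (use that assms in auto)
qed (use assms fixed_point_unique[OF assms] in blast)+

lemma bounded_orbit_Cauchy:
  assumes x: "x \<in> X" and bdd: "G_bounded G {(T ^^ n) x |n. n \<ge> 1}"
  shows "G_Cauchy G (\<lambda>n. (T ^^ n) x)"
  unfolding G_Cauchy_def
proof (intro allI impI)
  fix \<epsilon> :: real
  assume "\<epsilon> > 0"
  let ?Y = "{(T ^^ n) x |n. n \<ge> 1}"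
  obtain M where "\<forall>v\<in>{G a b c |a b c. a \<in> ?Y \<and> b \<in> ?Y \<and> c \<in> ?Y}. v \<le> M"
    using bdd unfolding G_bounded_def bdd_above_def ..
  then have M: "G ((T ^^ i) x) ((T ^^ j) x) ((T ^^ k) x) \<le> M"
    if "i \<ge> 1" "j \<ge> 1" "k \<ge> 1" for i j k
    using that by blast
  have "eventually (\<lambda>n. G_Lip X G (T ^^ n) * M < \<epsilon> \<and> n \<ge> 1) sequentially"
    by (intro eventually_conj order_tendstoD(2)[OF tendsto_mult_left_zero[OF Lip_tendsto] \<open>\<epsilon> > 0\<close>]
        eventually_ge_at_top)
  then obtain N where N: "G_Lip X G (T ^^ N) * M < \<epsilon>" "N \<ge> 1"
    by (auto dest: eventually_happens)
  have Lip_nonneg: "G_Lip X G (T ^^ N) \<ge> 0"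
    using G_Lip_is_least(1)[of "T ^^ N"] T_Lipschitzian N(2) by (auto simp: G_Lipschitz_const_def)
  \<comment> \<open>The threshold is \<open>N + 1\<close>, not \<open>N\<close>: after removing
    \<open>N\<close> iterations the exponents must still be at least 1, since \<open>M\<close> only
    bounds the orbit from the first iterate on.\<close>
  have "G ((T ^^ n) x) ((T ^^ m) x) ((T ^^ m) x) < \<epsilon>" if "m \<ge> N + 1" "n \<ge> N + 1" for m n
  proof -
    define i j where "i = n - N" and "j = m - N"
    have ij: "n = N + i" "m = N + j" "i \<ge> 1" "j \<ge> 1"
      using that by (auto simp: i_def j_def)
    have "G ((T ^^ n) x) ((T ^^ m) x) ((T ^^ m) x)
        \<le> G_Lip X G (T ^^ N) * G ((T ^^ i) x) ((T ^^ j) x) ((T ^^ j) x)"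
      using G_iterate_le[OF N(2) orbit_in orbit_in orbit_in, OF x x x] ij by (simp add: funpow_add)
    also have "\<dots> \<le> G_Lip X G (T ^^ N) * M"
      using M ij Lip_nonneg by (intro mult_left_mono) auto
    finally show ?thesis
      using N(1) by simp
  qed
  then show "\<exists>N. \<forall>m\<ge>N. \<forall>n\<ge>N. G ((T ^^ n) x) ((T ^^ m) x) ((T ^^ m) x) < \<epsilon>"
    by blast
qed

text \<open>As \<open>G\<close> is not assumed continuous, the limit is not taken inside
  \<open>G\<close>. Instead \<open>G5'\<close> passes from \<open>p\<close> to \<open>T p\<close>
  through \<open>u (Suc n) = T (u n)\<close>: the first term vanishes by convergence, the second by
  the Lipschitz bound for \<open>T\<close>.\<close>

lemma orbit_limit_fixed:
  assumes x: "x \<in> X" and p: "p \<in> X" and conv: "G_convergent_to G (\<lambda>n. (T ^^ n) x) p"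
  shows "T p = p"
proof (rule ccontr)
  assume neq: "T p \<noteq> p"
  define u where "u n = (T ^^ n) x" for n
  define k where "k = G_Lip X G T"
  have u: "u n \<in> X" "u (Suc n) = T (u n)" for n
    using orbit_in[OF x] by (auto simp: u_def)
  have Tp: "T p \<in> X"
    using T_maps p by auto
  have k: "k \<ge> 0"
    using G_Lip_is_least(1)[of "T ^^ 1"] T_Lipschitzian by (auto simp: G_Lipschitz_const_def k_def)
  have lim: "(\<lambda>n. G p (u n) (u n)) \<longlonglongrightarrow> 0"
    using G_convergent_toD[OF conv] by (simp add: u_def)
  have "(\<lambda>n. K * (G p (u (Suc n)) (u (Suc n)) + k * (2 * K * G p (u n) (u n))))
      \<longlonglongrightarrow> K * (0 + k * (2 * K * 0))"
    by (intro tendsto_intros lim LIMSEQ_Suc[OF lim])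
  moreover have "G p (T p) (T p)
      \<le> K * (G p (u (Suc n)) (u (Suc n)) + k * (2 * K * G p (u n) (u n)))" for n
  proof -
    have "G (u (Suc n)) (T p) (T p) \<le> k * G (u n) p p"
      using G_iterate_le[of 1 "u n" p p] u p by (simp add: k_def)
    \<comment> \<open>Convergence to \<open>p\<close> controls \<open>G p (u n) (u n)\<close>,
      whereas the Lipschitz bound produced \<open>G (u n) p p\<close>.\<close>
    also have "\<dots> \<le> k * (2 * K * G p (u n) (u n))"
      using G_swap_le u p k by (intro mult_left_mono) auto
    finally have "K * (G p (u (Suc n)) (u (Suc n)) + G (u (Suc n)) (T p) (T p))
        \<le> K * (G p (u (Suc n)) (u (Suc n)) + k * (2 * K * G p (u n) (u n)))"
      using K_pos by (intro mult_left_mono) auto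
    with G5'[OF p Tp Tp u(1), of "Suc n"] show ?thesis
      by linarith
  qed
  ultimately have "G p (T p) (T p) \<le> 0"
    using LIMSEQ_le_const by fastforce
  with G2[OF Tp p neq] G4[OF p Tp Tp] show False
    by simp
qed

end

theorem theorem2p3:
  fixes X :: "'a set" and G :: "'a \<Rightarrow> 'a \<Rightarrow> 'a \<Rightarrow> real" and K :: real and T :: "'a \<Rightarrow> 'a"
  assumes "generalized_G_metric X G K"
    and "G_complete X G"
    and "T \<in> X \<rightarrow> X"
    and "\<forall>n\<ge>1. G_Lipschitzian X G (T ^^ n)"
    and "(\<lambda>n. G_Lip X G (T ^^ n)) \<longlonglongrightarrow> 0"
  shows "((\<exists>!p. p \<in> X \<and> T p = p) \<longleftrightarrow> (\<exists>x\<in>X. G_bounded G {(T ^^ n) x |n. n \<ge> 1}))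
       \<and> ((\<exists>p\<in>X. T p = p) \<longrightarrow> Picard_operator X G T)"
proof -
  interpret G_metric_vanishing_Lip X G K T
    using assms by (intro G_metric_vanishing_Lip.intro G_metric_vanishing_Lip_axioms.intro)
  \<comment> \<open>The orbit of a fixed point is a single point, so \<open>G p p p\<close> is the
    only value to bound.\<close>
  have "G_bounded G {(T ^^ n) p |n. n \<ge> 1}" if "T p = p" for p
  proof -
    have fixp: "(T ^^ n) p = p" for n
      using that by (induction n) auto
    show ?thesis
      by (auto simp: G_bounded_def fixp intro!: bdd_aboveI[of _ "G p p p"])
  qed
  then have fixed_bounded: "\<exists>x\<in>X. G_bounded G {(T ^^ n) x |n. n \<ge> 1}" if "p \<in> X" "T p = p" for p
    using that by blast
  have bounded_fixed: "\<exists>!p. p \<in> X \<and> T p = p"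
    if x: "x \<in> X" and bdd: "G_bounded G {(T ^^ n) x |n. n \<ge> 1}" for x
  proof -
    \<comment> \<open>Completeness supplies a limit of the Cauchy orbit, the candidate fixed
      point.\<close>
    obtain p where p: "p \<in> X" "G_convergent_to G (\<lambda>n. (T ^^ n) x) p"
      using assms(2)[unfolded G_complete_def, rule_format, of "\<lambda>n. (T ^^ n) x"]
        bounded_orbit_Cauchy[OF x bdd] orbit_in[OF x] by auto
    then have "T p = p"
      by (rule orbit_limit_fixed[OF x])
    with p(1) show ?thesis
      by (blast intro: fixed_point_unique)
  qed
  show ?thesis
  proof (intro conjI iffI impI)
    assume "\<exists>!p. p \<in> X \<and> T p = p"
    then show "\<exists>x\<in>X. G_bounded G {(T ^^ n) x |n. n \<ge> 1}"
      using fixed_bounded by (elim ex1E conjE)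
  next
    assume "\<exists>x\<in>X. G_bounded G {(T ^^ n) x |n. n \<ge> 1}"
    then show "\<exists>!p. p \<in> X \<and> T p = p"
      by (elim bexE) (rule bounded_fixed)
  next
    assume "\<exists>p\<in>X. T p = p"
    then show "Picard_operator X G T"
      by (elim bexE) (rule Picard_operator_if_fixed_point)
  qed
qed

end
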